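(* Assume the enhanced-tail same-gauge selector: for every intrinsic package $\mathcal D$ a representative $\zeta_\ast(\mathcal D)\in\Gamma_\Lambda^{\mathrm{int}}$ is fixed, $\mathcal D_\ast:=\mathcal D-\zeta_\ast(\mathcal D)$, and there is $\delta_{\mathrm{sel}}^\sharp\ge0$ such that for all $\mathcal D$ $$\|\mathcal D_\ast\|_{\mathrm{loc,int}}+\alpha_{\mathrm{proj}}\mathcal T_{\mathrm{proj}}(\mathcal D;\zeta_\ast)+\alpha_{\mathrm{harm}}\mathcal T_{\mathrm{harm}}(\mathcal D;\zeta_\ast)\le\operatorname{dist}^{\sharp,\mathrm{tail}}(\mathcal D)+\delta_{\mathrm{sel}}^\sharp.$$ For $a\in\{\mathrm{det},\mathrm{tax},\mathrm{slack}\}$ let $K_{\mathrm{gate}}^a:\mathfrak I_\Lambda^{\mathrm{loc}}\to Y_{\mathrm{gate}}^a$ be bounded linear operators into finite-dimensional normed spaces, with operator norms $C_{\mathrm{gate}}^a$, and define the gate/tax mismatch residual $\mathcal R_{\mathrm{gate}}(\mathcal D)=\sum_a\|K_{\mathrm{gate}}^a\mathcal D_\ast\|_{Y_{\mathrm{gate}}^a}$. Set $C_{\mathrm{gate}}=C_{\mathrm{gate}}^{\mathrm{det}}+C_{\mathrm{gate}}^{\mathrm{tax}}+C_{\mathrm{gate}}^{\mathrm{slack}}$. Then for every intrinsic package $\mathcal D$, $$\mathcal R_{\mathrm{gate}}(\mathcal D)\le C_{\mathrm{gate}}\operatorname{dist}^{\sharp,\mathrm{tail}}(\mathcal D)+C_{\mathrm{gate}}\delta_{\mathrm{sel}}^\sharp,$$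 i.e. $\mathcal R_{\mathrm{gate}}(\mathcal D)\le\eta_{\mathrm{gate}}\operatorname{dist}^{\sharp,\mathrm{tail}}(\mathcal D)+\Delta_{\mathrm{gate}}$ with $\eta_{\mathrm{gate}}=C_{\mathrm{gate}}$ and $\Delta_{\mathrm{gate}}=C_{\mathrm{gate}}\delta_{\mathrm{sel}}^\sharp$. If the selector is an exact enhanced-tail minimizer, then one may take $\delta_{\mathrm{sel}}^\sharp=0$ and $\Delta_{\mathrm{gate}}=0$.
   Context: Intrinsic packages. $\Lambda$ is a finite set of consecutive integers. For $k\in\Lambda$, $j=1,\dots,7$, let $X_k^{(j)}$ be normed spaces; an intrinsic package is $\mathcal D=(x_k^{(j)})_{k,j}$, $x_k^{(j)}\in X_k^{(j)}$, with norm $\|\mathcal D\|_{\mathrm{loc,int}}^2=\sum_{k}\sum_{j}a_j\|x_k^{(j)}\|^2$, $a_j>0$ fixed; $\mathfrak I_\Lambda^{\mathrm{loc}}$ is the space of intrinsic packages with this norm and $\Gamma_\Lambda^{\mathrm{int}}\subset\mathfrak I_\Lambda^{\mathrm{loc}}$ a linear subspace. Enhanced-tail distance. Let $B_r\subset\mathbb R^3$ be the ball of radius $r$ about $0$, $I=(-1,0)$, $Y_{\mathrm{prs}}=L^{3/2}(I;L^{3/2}(B_{1/2}))$, and $\mathsf R_i$ the Riesz transforms on $\mathbb R^3$ (tensors on $B_1$ are extended by zero, repeated indices summed, results restricted to $B_{1/2}$). Each package $\mathcal D$ carries a clean source tensor $F^{\mathrm{cl}}_{ij}(\mathcal D)=U_iU_j+R_{ij}\in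 L^{3/2}(I;L^{3/2}(B_1))$ built from its clean velocity and covariance coordinates $U,R$, and a harmonic pressure component $p_{\mathrm{harm}}(\mathcal D)$ in a normed space $Y_{\mathrm{harm}}$. $P_{\mathrm{prs},N}^{\mathrm{cl}}$ is a bounded linear projection on $Y_{\mathrm{prs}}$, $\Pi_{\mathrm{harm},M}$ a bounded projection of $Y_{\mathrm{harm}}$ onto a finite-dimensional subspace, $J_{\mathrm{harm}}:Y_{\mathrm{harm}}\to Y_{\mathrm{prs}}$ bounded linear. For $\zeta\in\Gamma_\Lambda^{\mathrm{int}}$, $\mathcal T_{\mathrm{proj}}(\mathcal D;\zeta)=(1+\|P_{\mathrm{prs},N}^{\mathrm{cl}}\|)\|\mathsf R_i\mathsf R_jF_{ij}^{\mathrm{cl}}(\mathcal D-\zeta)\|_{Y_{\mathrm{prs}}}$, $\mathcal T_{\mathrm{harm}}(\mathcal D;\zeta)=\|J_{\mathrm{harm}}\|\,\|(I-\Pi_{\mathrm{harm},M})p_{\mathrm{harm}}(\mathcal D-\zeta)\|_{Y_{\mathrm{harm}}}$. For fixed $\alpha_{\mathrm{proj}},\alpha_{\mathrm{harm}}>0$, $$\operatorname{dist}^{\sharp,\mathrm{tail}}(\mathcal D)=\inf_{\zeta\in\Gamma_\Lambda^{\mathrm{int}}}\big(\|\mathcal D-\zeta\|_{\mathrm{loc,int}}+\alpha_{\mathrm{proj}}\mathcal T_{\mathrm{proj}}(\mathcal D;\zeta)+\alpha_{\mathrm{harm}}\mathcal T_{\mathrm{harm}}(\mathcal D;\zeta)\big).$$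 *)

theory Defs
  imports "HOL-Analysis.Analysis" "HOL-Library.Function_Algebras"
begin

section \<open>Pointwise vector space structure on functions\<close>

instantiation "fun" :: (type, real_vector) real_vector
begin

definition scaleR_fun :: "real \<Rightarrow> ('a \<Rightarrow> 'b) \<Rightarrow> 'a \<Rightarrow> 'b"
  where "scaleR_fun c f = (\<lambda>x. c *\<^sub>R f x)"

instance
  by standard (auto simp: scaleR_fun_def plus_fun_def fun_eq_iff scaleR_add_right scaleR_add_left)

end


section \<open>Lebesgue spaces\<close>

definition Lp_space :: "real \<Rightarrow> 'a measure \<Rightarrow> ('a \<Rightarrow> real) set"
  where "Lp_space p M = {f \<in> borel_measurable M. integrable M (\<lambda>x. \<bar>f x\<bar> powr p)}"

definition Lp_norm :: "real \<Rightarrow> 'a measure \<Rightarrow> ('a \<Rightarrow> real) \<Rightarrow> real"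
  where "Lp_norm p M f = (LINT x|M. \<bar>f x\<bar> powr p) powr (1 / p)"

lemma powr_convex_nonneg:
  fixes x y u v p :: real
  assumes "p \<ge> 1" "x \<ge> 0" "y \<ge> 0" "u \<ge> 0" "v \<ge> 0" "u + v = 1"
  shows "(u * x + v * y) powr p \<le> u * x powr p + v * y powr p"
proof -
  have *: "(w * z) powr p \<le> w * z powr p" if "0 \<le> w" "w \<le> 1" "0 \<le> z" for w z :: real
  proof (cases "w = 0")
    case False
    have "w powr p \<le> w powr 1"
      using that False assms(1) by (intro powr_mono') auto
    then have "w powr p * z powr p \<le> w * z powr p"
      using that by (intro mult_right_mono) auto
    then show ?thesis using that by (simp add: powr_mult)
  qed simp
  consider "x = 0" | "y = 0" | "x > 0" "y > 0" using assms by linarith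
  then show ?thesis
  proof cases
    case 1 then show ?thesis using *[of v y] assms by simp
  next
    case 2 then show ?thesis using *[of u x] assms by simp
  next
    case 3
    have u: "u = 1 - v" using assms by simp
    show ?thesis
      using convex_onD[OF powr_convex[OF assms(1)], of v x y] assms 3 by (simp add: u)
  qed
qed

lemma Lp_space_add:
  assumes p: "p \<ge> 1" and f: "f \<in> Lp_space p M" and g: "g \<in> Lp_space p M"
  shows "(\<lambda>x. f x + g x) \<in> Lp_space p M"
proof -
  have [measurable]: "f \<in> borel_measurable M" "g \<in> borel_measurable M"
    and i: "integrable M (\<lambda>x. \<bar>f x\<bar> powr p)" "integrable M (\<lambda>x. \<bar>g x\<bar> powr p)"
    using f g by (auto simp: Lp_space_def)
  have "integrable M (\<lambda>x. \<bar>f x + g x\<bar> powr p)"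
  proof (rule Bochner_Integration.integrable_bound)
    show "integrable M (\<lambda>x. 2 powr p * (1/2 * \<bar>f x\<bar> powr p + 1/2 * \<bar>g x\<bar> powr p))"
      by (intro integrable_mult_right Bochner_Integration.integrable_add i)
    show "AE x in M. norm (\<bar>f x + g x\<bar> powr p)
            \<le> norm (2 powr p * (1/2 * \<bar>f x\<bar> powr p + 1/2 * \<bar>g x\<bar> powr p))"
    proof (rule AE_I2)
      fix x
      have "\<bar>f x + g x\<bar> powr p \<le> (2 * (1/2 * \<bar>f x\<bar> + 1/2 * \<bar>g x\<bar>)) powr p"
        using p by (intro powr_mono2) auto
      also have "\<dots> = 2 powr p * (1/2 * \<bar>f x\<bar> + 1/2 * \<bar>g x\<bar>) powr p"
        by (rule powr_mult)
      also have "\<dots> \<le> 2 powr p * (1/2 * \<bar>f x\<bar> powr p + 1/2 * \<bar>g x\<bar> powr p)"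
        using p by (intro mult_left_mono powr_convex_nonneg) auto
      finally show "norm (\<bar>f x + g x\<bar> powr p)
            \<le> norm (2 powr p * (1/2 * \<bar>f x\<bar> powr p + 1/2 * \<bar>g x\<bar> powr p))" by simp
    qed
  qed simp
  then show ?thesis by (simp add: Lp_space_def)
qed

lemma Lp_space_scale:
  assumes f: "f \<in> Lp_space p M"
  shows "(\<lambda>x. c * f x) \<in> Lp_space p M"
  using assms by (auto simp: Lp_space_def abs_mult powr_mult)

lemma Lp_norm_nonneg: "Lp_norm p M f \<ge> 0"
  by (simp add: Lp_norm_def)

lemma Lp_norm_scale:
  assumes "p \<ge> 1"
  shows "Lp_norm p M (\<lambda>x. c * f x) = \<bar>c\<bar> * Lp_norm p M f"
  using assms by (simp add: Lp_norm_def abs_mult powr_mult powr_powr)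

lemma Lp_norm_powr:
  assumes "p \<ge> 1"
  shows "Lp_norm p M f powr p = (LINT x|M. \<bar>f x\<bar> powr p)"
  using assms by (simp add: Lp_norm_def powr_powr)

lemma Lp_norm_eq_0_iff:
  assumes p: "p \<ge> 1" and f: "f \<in> Lp_space p M"
  shows "Lp_norm p M f = 0 \<longleftrightarrow> (AE x in M. f x = 0)"
proof -
  have "Lp_norm p M f = 0 \<longleftrightarrow> (LINT x|M. \<bar>f x\<bar> powr p) = 0"
    by (simp add: Lp_norm_def)
  also have "\<dots> \<longleftrightarrow> (AE x in M. \<bar>f x\<bar> powr p = 0)"
    using f by (intro integral_nonneg_eq_0_iff_AE) (auto simp: Lp_space_def)
  finally show ?thesis by simp
qed

lemma Lp_norm_cong_AE:
  assumes "f \<in> borel_measurable M" "g \<in> borel_measurable M" "AE x in M. f x = g x"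
  shows "Lp_norm p M f = Lp_norm p M g"
proof -
  have "(LINT x|M. \<bar>f x\<bar> powr p) = (LINT x|M. \<bar>g x\<bar> powr p)"
    using assms by (intro integral_cong_AE) auto
  then show ?thesis by (simp add: Lp_norm_def)
qed

lemma Lp_norm_triangle:
  assumes p: "p \<ge> 1" and f: "f \<in> Lp_space p M" and g: "g \<in> Lp_space p M"
  shows "Lp_norm p M (\<lambda>x. f x + g x) \<le> Lp_norm p M f + Lp_norm p M g"
proof -
  have m: "f \<in> borel_measurable M" "g \<in> borel_measurable M"
    and i: "integrable M (\<lambda>x. \<bar>f x\<bar> powr p)" "integrable M (\<lambda>x. \<bar>g x\<bar> powr p)"
    using f g by (auto simp: Lp_space_def)
  define a where "a = Lp_norm p M f"
  define b where "b = Lp_norm p M g"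
  have a0: "a \<ge> 0" and b0: "b \<ge> 0" by (simp_all add: a_def b_def Lp_norm_nonneg)
  note fg = Lp_space_add[OF p f g]
  consider "a = 0" | "b = 0" | "a > 0" "b > 0" using a0 b0 by linarith
  then show ?thesis
  proof cases
    case 1
    then have "AE x in M. f x = 0" using Lp_norm_eq_0_iff[OF p f] by (simp add: a_def)
    then have "Lp_norm p M (\<lambda>x. f x + g x) = Lp_norm p M g"
      using m by (intro Lp_norm_cong_AE) auto
    then show ?thesis by (simp add: Lp_norm_nonneg)
  next
    case 2
    then have "AE x in M. g x = 0" using Lp_norm_eq_0_iff[OF p g] by (simp add: b_def)
    then have "Lp_norm p M (\<lambda>x. f x + g x) = Lp_norm p M f"
      using m by (intro Lp_norm_cong_AE) auto
    then show ?thesis by (simp add: Lp_norm_nonneg)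
  next
    case 3
    let ?u = "a / (a + b)" and ?v = "b / (a + b)"
    have uv: "?u \<ge> 0" "?v \<ge> 0" "?u + ?v = 1" using 3 by (auto simp: add_divide_distrib[symmetric])
    have If: "(LINT x|M. \<bar>f x\<bar> powr p) = a powr p" and Ig: "(LINT x|M. \<bar>g x\<bar> powr p) = b powr p"
      by (simp_all add: a_def b_def Lp_norm_powr[OF p])
    have pt: "\<bar>f x + g x\<bar> powr p \<le>
        (a + b) powr p * (?u * (\<bar>f x\<bar> powr p / a powr p) + ?v * (\<bar>g x\<bar> powr p / b powr p))" for x
    proof -
      have "a + b \<noteq> 0" using 3 by simp
      then have e: "(a + b) * (?u * (\<bar>f x\<bar> / a) + ?v * (\<bar>g x\<bar> / b)) = \<bar>f x\<bar> + \<bar>g x\<bar>"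
        using 3 by (simp add: distrib_left)
      have "\<bar>f x + g x\<bar> powr p \<le> ((a + b) * (?u * (\<bar>f x\<bar> / a) + ?v * (\<bar>g x\<bar> / b))) powr p"
        unfolding e using p by (intro powr_mono2) auto
      also have "\<dots> = (a + b) powr p * (?u * (\<bar>f x\<bar> / a) + ?v * (\<bar>g x\<bar> / b)) powr p"
        by (rule powr_mult)
      also have "\<dots> \<le> (a + b) powr p * (?u * (\<bar>f x\<bar> / a) powr p + ?v * (\<bar>g x\<bar> / b) powr p)"
        using p 3 uv by (intro mult_left_mono powr_convex_nonneg) auto
      finally show ?thesis using 3 by (simp add: powr_divide)
    qed
    have "(LINT x|M. \<bar>f x + g x\<bar> powr p) \<le>
        (LINT x|M. (a + b) powr p * (?u * (\<bar>f x\<bar> powr p / a powr p) + ?v * (\<bar>g x\<bar> powr p / b powr p)))"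
      using fg i pt by (intro integral_mono) (auto simp: Lp_space_def)
    also have "\<dots> = (a + b) powr p * (?u * (a powr p / a powr p) + ?v * (b powr p / b powr p))"
      using i by (simp add: If Ig)
    also have "\<dots> = (a + b) powr p" using 3 uv by simp
    finally have "Lp_norm p M (\<lambda>x. f x + g x) powr p \<le> (a + b) powr p"
      by (simp only: Lp_norm_powr[OF p])
    then have "Lp_norm p M (\<lambda>x. f x + g x) \<le> a + b"
      using p a0 b0 powr_less_mono2[of p "a + b" "Lp_norm p M (\<lambda>x. f x + g x)"]
      by (force simp: not_less[symmetric])
    then show ?thesis by (simp add: a_def b_def)
  qed
qed


section \<open>The pressure space \<open>L\<^sup>3\<^sup>/\<^sup>2(I; L\<^sup>3\<^sup>/\<^sup>2(B\<^sub>r))\<close>\<close>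

text \<open>
  Space-time is \<^typ>\<open>real \<times> (real^3)\<close>, time first, and \<open>I = (-1,0)\<close>.  The Bochner space
  \<open>L\<^sup>3\<^sup>/\<^sup>2(I; L\<^sup>3\<^sup>/\<^sup>2(B\<^sub>r))\<close> is realised by jointly measurable functions on the cylinder
  \<open>I \<times> B\<^sub>r\<close>; lemma \<open>Lp_norm_cylinder_iterated\<close> recovers the iterated norm.
\<close>

type_synonym spacetime = "real \<times> (real^3)"

definition cylinder :: "real \<Rightarrow> spacetime measure"
  where "cylinder r = restrict_space lborel ({-1<..<0} \<times> ball 0 r)"

lemma Lp_norm_cylinder_iterated:
  assumes "f \<in> Lp_space (3/2) (cylinder r)"
  shows "Lp_norm (3/2) (cylinder r) f =
    (LINT t:{-1<..<0}|lborel.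
       Lp_norm (3/2) (restrict_space lborel (ball 0 r)) (\<lambda>x. f (t, x)) powr (3/2)) powr (2/3)"
proof -
  let ?A = "{-1<..<0::real}" and ?B = "ball (0::real^3) r"
  let ?h = "\<lambda>z. \<bar>f z\<bar> powr (3/2)"
  have AB: "?A \<times> ?B \<in> sets (lborel :: spacetime measure)"
    by (simp add: borel_open open_Times)
  have i: "integrable lborel (\<lambda>z. indicator (?A \<times> ?B) z *\<^sub>R ?h z)"
    using assms AB by (subst integrable_restrict_space[symmetric])
      (auto simp: Lp_space_def cylinder_def)
  have "(LINT z|cylinder r. ?h z) = (LINT z|lborel. indicator (?A \<times> ?B) z *\<^sub>R ?h z)"
    using AB unfolding cylinder_def by (subst integral_restrict_space) auto
  also have "\<dots> = (LINT t|lborel. LINT x|lborel. indicator (?A \<times> ?B) (t, x) *\<^sub>R ?h (t, x))"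
    using lborel_pair.integral_fst'[of "\<lambda>z. indicator (?A \<times> ?B) z *\<^sub>R ?h z"] i
    by (simp add: lborel_prod)
  also have "\<dots> = (LINT t:?A|lborel. LINT x:?B|lborel. ?h (t, x))"
    unfolding set_lebesgue_integral_def
    by (intro Bochner_Integration.integral_cong) (auto simp: indicator_times mult.assoc)
  also have "\<dots> = (LINT t:?A|lborel.
       Lp_norm (3/2) (restrict_space lborel ?B) (\<lambda>x. f (t, x)) powr (3/2))"
    by (simp add: Lp_norm_powr integral_restrict_space set_lebesgue_integral_def)
  finally show ?thesis by (simp add: Lp_norm_def)
qed

abbreviation cylL :: "(spacetime \<Rightarrow> real) set"
  where "cylL \<equiv> Lp_space (3/2) (cylinder (1/2))"

definition prs_rel :: "(spacetime \<Rightarrow> real) \<Rightarrow> (spacetime \<Rightarrow> real) \<Rightarrow> bool"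
  where "prs_rel f g \<longleftrightarrow> f \<in> cylL \<and> g \<in> cylL \<and> (AE z in cylinder (1/2). f z = g z)"

quotient_type prs = "spacetime \<Rightarrow> real" / partial: prs_rel
  morphisms rep_prs prs_class
proof (rule part_equivpI)
  show "\<exists>f. prs_rel f f"
    by (intro exI[of _ "\<lambda>_. 0"]) (simp add: prs_rel_def Lp_space_def)
  show "symp prs_rel"
    by (rule sympI) (auto simp: prs_rel_def elim: AE_mp)
  show "transp prs_rel"
    by (rule transpI) (auto simp: prs_rel_def)
qed

instantiation prs :: real_normed_vector
begin

lift_definition zero_prs :: prs is "\<lambda>_. 0"
  by (simp add: prs_rel_def Lp_space_def)

lift_definition plus_prs :: "prs \<Rightarrow> prs \<Rightarrow> prs" is "\<lambda>f g z. f z + g z"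
  by (auto simp: prs_rel_def intro!: Lp_space_add)

lift_definition scaleR_prs :: "real \<Rightarrow> prs \<Rightarrow> prs" is "\<lambda>c f z. c * f z"
  by (auto simp: prs_rel_def intro!: Lp_space_scale)

definition uminus_prs :: "prs \<Rightarrow> prs" where "uminus_prs f = (-1) *\<^sub>R f"

definition minus_prs :: "prs \<Rightarrow> prs \<Rightarrow> prs" where "minus_prs f g = f + - g"

lift_definition norm_prs :: "prs \<Rightarrow> real" is "Lp_norm (3/2) (cylinder (1/2))"
  by (auto simp: prs_rel_def Lp_space_def intro!: Lp_norm_cong_AE)

definition sgn_prs :: "prs \<Rightarrow> prs" where "sgn_prs f = inverse (norm f) *\<^sub>R f"

definition dist_prs :: "prs \<Rightarrow> prs \<Rightarrow> real" where "dist_prs f g = norm (f - g)"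

definition uniformity_prs :: "(prs \<times> prs) filter"
  where "uniformity_prs = (INF e\<in>{0<..}. principal {(f, g). dist f g < e})"

definition open_prs :: "prs set \<Rightarrow> bool"
  where "open_prs U \<longleftrightarrow> (\<forall>f\<in>U. eventually (\<lambda>(f', g). f' = f \<longrightarrow> g \<in> U) uniformity)"

instance
proof
  fix a b c :: prs and r s :: real
  show "a + b + c = a + (b + c)"
    by transfer (auto simp: prs_rel_def add.assoc intro!: Lp_space_add)
  show "a + b = b + a"
    by transfer (auto simp: prs_rel_def add.commute intro!: Lp_space_add)
  show "0 + a = a" by transfer (auto simp: prs_rel_def)
  show "- a + a = 0"
    unfolding uminus_prs_def
    by transfer (auto simp: prs_rel_def Lp_space_def)
  show "a - b = a + - b" by (rule minus_prs_def)
  show "r *\<^sub>R (a + b) = r *\<^sub>R a + r *\<^sub>R b"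
    by transfer (auto simp: prs_rel_def distrib_left intro!: Lp_space_add Lp_space_scale)
  show "(r + s) *\<^sub>R a = r *\<^sub>R a + s *\<^sub>R a"
    by transfer (auto simp: prs_rel_def distrib_right intro!: Lp_space_add Lp_space_scale)
  show "r *\<^sub>R s *\<^sub>R a = (r * s) *\<^sub>R a"
    by transfer (auto simp: prs_rel_def Lp_space_scale mult.assoc intro!: Lp_space_scale)
  show "1 *\<^sub>R a = a" by transfer (auto simp: prs_rel_def)
  show "dist a b = norm (a - b)" by (rule dist_prs_def)
  show "sgn a = inverse (norm a) *\<^sub>R a" by (rule sgn_prs_def)
  show "uniformity = (INF e\<in>{0<..}. principal {(x, y :: prs). dist x y < e})"
    by (rule uniformity_prs_def)
  show "open U = (\<forall>x\<in>U. \<forall>\<^sub>F (x', y) in uniformity. x' = x \<longrightarrow> y \<in> U)" for U :: "prs set"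
    by (rule open_prs_def)
  show "norm a = 0 \<longleftrightarrow> a = 0"
    by transfer (auto simp: prs_rel_def Lp_norm_eq_0_iff Lp_space_def)
  show "norm (a + b) \<le> norm a + norm b"
    by transfer (auto simp: prs_rel_def intro!: Lp_norm_triangle)
  show "norm (r *\<^sub>R a) = \<bar>r\<bar> * norm a"
    by transfer (simp add: Lp_norm_scale)
qed

end


section \<open>Riesz transforms\<close>

text \<open>
  On \<open>\<real>\<^sup>n\<close> the constant is \<open>\<Gamma>((n+1)/2) / \<pi>\<^bsup>(n+1)/2\<^esup>\<close>, which is \<open>1/\<pi>\<^sup>2\<close> for \<open>n = 3\<close>.
  The principal value exists almost everywhere for \<open>f \<in> L\<^sup>p\<close>, \<open>1 < p < \<infinity>\<close>; on the exceptional
  null set \<^const>\<open>Lim\<close> returns a fixed unspecified number.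
\<close>

definition riesz :: "3 \<Rightarrow> (real^3 \<Rightarrow> real) \<Rightarrow> real^3 \<Rightarrow> real"
  where "riesz i f x = Lim (at_right 0) (\<lambda>\<epsilon>.
    LINT y:{y. \<epsilon> < norm (x - y)}|lborel. 1 / pi\<^sup>2 * ((x - y) $ i / norm (x - y) ^ 4) * f y)"

definition ext_zero :: "(real^3) set \<Rightarrow> (real^3 \<Rightarrow> real) \<Rightarrow> real^3 \<Rightarrow> real"
  where "ext_zero B f x = (if x \<in> B then f x else 0)"

definition riesz_riesz :: "(real \<Rightarrow> real^3 \<Rightarrow> real^3^3) \<Rightarrow> spacetime \<Rightarrow> real"
  where "riesz_riesz F = (\<lambda>(t, x).
    \<Sum>i\<in>UNIV. \<Sum>j\<in>UNIV. riesz i (riesz j (ext_zero (ball 0 1) (\<lambda>y. F t y $ i $ j))) x)"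


section \<open>Intrinsic packages and the enhanced-tail distance\<close>

type_synonym 'x package = "int \<Rightarrow> nat \<Rightarrow> 'x"

text \<open>
  The normed spaces \<open>X\<^sub>k\<^sup>(\<^sup>j\<^sup>)\<close> are linear subspaces \<open>X k j\<close> of one ambient normed space
  \<^typ>\<open>'x\<close>, with the inherited norm.  This is no restriction: a finite family of normed spaces
  embeds isometrically into its direct sum.  The coordinates \<open>vel\<close> (\<open>U\<close>) and \<open>cov\<close> (\<open>R\<close>) and the
  component \<open>p_harm\<close> may be any maps on packages; neither linearity nor continuity is required.
\<close>

record ('x, 'h) tail_setting =
  Lam :: "int set"
  X :: "int \<Rightarrow> nat \<Rightarrow> 'x set"
  wt :: "nat \<Rightarrow> real"
  Gam :: "'x package set"
  vel :: "'x package \<Rightarrow> real \<Rightarrow> real^3 \<Rightarrow> real^3"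
  cov :: "'x package \<Rightarrow> real \<Rightarrow> real^3 \<Rightarrow> real^3^3"
  p_harm :: "'x package \<Rightarrow> 'h"
  P_prs :: "prs \<Rightarrow> prs"
  Pi_harm :: "'h \<Rightarrow> 'h"
  J_harm :: "'h \<Rightarrow> prs"
  alpha_proj :: real
  alpha_harm :: real

text \<open>Packages vanish outside \<open>\<Lambda> \<times> {1,\<dots>,7}\<close>, so that equality of packages is equality of functions.\<close>

definition packages :: "('x::real_normed_vector, 'h) tail_setting \<Rightarrow> 'x package set"
  where "packages S = {D. \<forall>k j.
    (k \<in> Lam S \<and> j \<in> {1..7} \<longrightarrow> D k j \<in> X S k j) \<and> (\<not> (k \<in> Lam S \<and> j \<in> {1..7}) \<longrightarrow> D k j = 0)}"

definition norm_loc :: "('x::real_normed_vector, 'h) tail_setting \<Rightarrow> 'x package \<Rightarrow> real"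
  where "norm_loc S D = sqrt (\<Sum>k\<in>Lam S. \<Sum>j=1..7. wt S j * (norm (D k j))\<^sup>2)"

definition F_cl :: "('x, 'h) tail_setting \<Rightarrow> 'x package \<Rightarrow> real \<Rightarrow> real^3 \<Rightarrow> real^3^3"
  where "F_cl S D t x = (\<chi> i j. vel S D t x $ i * vel S D t x $ j + cov S D t x $ i $ j)"

definition finite_dimensional :: "'v::real_vector set \<Rightarrow> bool"
  where "finite_dimensional V \<longleftrightarrow> (\<exists>B. finite B \<and> V = span B)"

definition tail_setting_ok ::
    "('x::real_normed_vector, 'h::real_normed_vector) tail_setting \<Rightarrow> bool"
  where "tail_setting_ok S \<longleftrightarrow>
    (\<exists>m n. Lam S = {m..n}) \<and>
    (\<forall>k\<in>Lam S. \<forall>j\<in>{1..7}. subspace (X S k j)) \<and>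
    (\<forall>j\<in>{1..7}. wt S j > 0) \<and>
    subspace (Gam S) \<and> Gam S \<subseteq> packages S \<and>
    (\<forall>D\<in>packages S. \<forall>i j. (\<lambda>(t, x). F_cl S D t x $ i $ j) \<in> Lp_space (3/2) (cylinder 1)) \<and>
    bounded_linear (P_prs S) \<and> P_prs S \<circ> P_prs S = P_prs S \<and>
    bounded_linear (Pi_harm S) \<and> Pi_harm S \<circ> Pi_harm S = Pi_harm S \<and>
    finite_dimensional (range (Pi_harm S)) \<and>
    bounded_linear (J_harm S) \<and>
    alpha_proj S > 0 \<and> alpha_harm S > 0"

text \<open>
  By the Calderon-Zygmund theorem the double Riesz transform of \<open>F_cl\<close> lies in \<open>L\<^sup>3\<^sup>/\<^sup>2\<close>, so
  \<^const>\<open>prs_class\<close>, which also restricts to \<open>I \<times> B\<^bsub>1/2\<^esub>\<close>, is applied inside its domain.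
\<close>

definition T_proj :: "('x::real_normed_vector, 'h) tail_setting \<Rightarrow> 'x package \<Rightarrow> 'x package \<Rightarrow> real"
  where "T_proj S D \<zeta> =
    (1 + onorm (P_prs S)) * norm (prs_class (riesz_riesz (F_cl S (D - \<zeta>))))"

definition T_harm ::
    "('x::real_normed_vector, 'h::real_normed_vector) tail_setting \<Rightarrow> 'x package \<Rightarrow> 'x package \<Rightarrow> real"
  where "T_harm S D \<zeta> =
    onorm (J_harm S) * norm (p_harm S (D - \<zeta>) - Pi_harm S (p_harm S (D - \<zeta>)))"

definition tail_objective ::
    "('x::real_normed_vector, 'h::real_normed_vector) tail_setting \<Rightarrow> 'x package \<Rightarrow> 'x package \<Rightarrow> real"
  where "tail_objective S D \<zeta> =
    norm_loc S (D - \<zeta>) + alpha_proj S * T_proj S D \<zeta> + alpha_harm S * T_harm S D \<zeta>"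

definition dist_tail ::
    "('x::real_normed_vector, 'h::real_normed_vector) tail_setting \<Rightarrow> 'x package \<Rightarrow> real"
  where "dist_tail S D = (INF \<zeta>\<in>Gam S. tail_objective S D \<zeta>)"


section \<open>Selectors and gate operators\<close>

definition tail_selector ::
    "('x::real_normed_vector, 'h::real_normed_vector) tail_setting \<Rightarrow> real \<Rightarrow>
     ('x package \<Rightarrow> 'x package) \<Rightarrow> bool"
  where "tail_selector S \<delta> sel \<longleftrightarrow>
    (\<forall>D\<in>packages S. sel D \<in> Gam S \<and> tail_objective S D (sel D) \<le> dist_tail S D + \<delta>)"

definition exact_tail_minimizer ::
    "('x::real_normed_vector, 'h::real_normed_vector) tail_setting \<Rightarrow>
     ('x package \<Rightarrow> 'x package) \<Rightarrow> bool"
  where "exact_tail_minimizer S sel \<longleftrightarrow>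
    (\<forall>D\<in>packages S. is_arg_min (tail_objective S D) (\<lambda>\<zeta>. \<zeta> \<in> Gam S) (sel D))"

definition bounded_linear_pkg ::
    "('x::real_normed_vector, 'h) tail_setting \<Rightarrow> ('x package \<Rightarrow> 'y::real_normed_vector) \<Rightarrow> bool"
  where "bounded_linear_pkg S K \<longleftrightarrow>
    (\<forall>D\<in>packages S. \<forall>E\<in>packages S. K (D + E) = K D + K E) \<and>
    (\<forall>c. \<forall>D\<in>packages S. K (c *\<^sub>R D) = c *\<^sub>R K D) \<and>
    (\<exists>C. \<forall>D\<in>packages S. norm (K D) \<le> C * norm_loc S D)"

text \<open>The analogue of \<^const>\<open>onorm\<close> for operators on the package space.\<close>

definition onorm_pkg ::
    "('x::real_normed_vector, 'h) tail_setting \<Rightarrow> ('x package \<Rightarrow> 'y::real_normed_vector) \<Rightarrow> real"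
  where "onorm_pkg S K = (SUP D\<in>packages S. norm (K D) / norm_loc S D)"

definition gate_residual ::
    "('x package \<Rightarrow> 'x package) \<Rightarrow> ('x package \<Rightarrow> 'g1::real_normed_vector) \<Rightarrow>
     ('x package \<Rightarrow> 'g2::real_normed_vector) \<Rightarrow> ('x package \<Rightarrow> 'g3::real_normed_vector) \<Rightarrow>
     'x::real_normed_vector package \<Rightarrow> real"
  where "gate_residual sel K_det K_tax K_slack D =
    norm (K_det (D - sel D)) + norm (K_tax (D - sel D)) + norm (K_slack (D - sel D))"

end

theory Submission
  imports Defs
begin

text \<open>The two tail terms are nonnegative, so the enhanced-tail objective dominates the plain
  norm of \<open>D - \<zeta>\<close> (\<open>norm_loc_le_tail_objective\<close>). At
  \<open>\<zeta> = sel D\<close> the selector bounds that objective by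
  \<open>dist_tail S D + \<delta>\<close>, hence the cleaned package \<open>D - sel D\<close> has
  norm at most this. Each gate operator costs at most its operator norm on the cleaned package
  (\<open>norm_le_onorm_pkg\<close>), and adding the three bounds gives the factor
  \<open>C_gate\<close>. An exact minimizer attains the infimum, so the same estimate applies with
  \<open>\<delta> = 0\<close>.\<close>

lemma norm_loc_nonneg:
  assumes "tail_setting_ok S"
  shows "0 \<le> norm_loc S D"
proof -
  have "0 \<le> wt S j" if "j \<in> {1..7}" for j
    using assms that unfolding tail_setting_ok_def by (meson less_imp_le)
  then show ?thesis
    unfolding norm_loc_def by (intro real_sqrt_ge_zero sum_nonneg mult_nonneg_nonneg) auto
qed

lemma zero_in_packages:
  assumes "tail_setting_ok S"
  shows "0 \<in> packages S"
  using assms by (auto simp: tail_setting_ok_def packages_def subspace_0)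

lemma diff_in_packages:
  assumes "tail_setting_ok S" "D \<in> packages S" "E \<in> packages S"
  shows "D - E \<in> packages S"
  using assms by (auto simp: tail_setting_ok_def packages_def intro: subspace_diff)

text \<open>Each tail is a norm times a factor built from an operator norm, and operator norms of
  bounded linear maps are nonnegative.\<close>

lemma norm_loc_le_tail_objective:
  assumes "tail_setting_ok S"
  shows "norm_loc S (D - \<zeta>) \<le> tail_objective S D \<zeta>"
proof -
  have bl: "bounded_linear (P_prs S)" "bounded_linear (J_harm S)"
    and "0 < alpha_proj S" "0 < alpha_harm S"
    using assms by (auto simp: tail_setting_ok_def)
  moreover have "0 \<le> T_proj S D \<zeta>" "0 \<le> T_harm S D \<zeta>"
    unfolding T_proj_def T_harm_def
    using onorm_pos_le[OF bl(1)] onorm_pos_le[OF bl(2)] by simp_all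
  ultimately show ?thesis
    by (simp add: tail_objective_def add_nonneg_nonneg add.assoc)
qed

text \<open>A real supremum is an upper bound only for a family bounded above; this licenses every
  later use of \<open>onorm_pkg\<close>.\<close>

lemma bdd_above_onorm_pkg:
  assumes "tail_setting_ok S" "bounded_linear_pkg S K"
  shows "bdd_above ((\<lambda>D. norm (K D) / norm_loc S D) ` packages S)"
proof -
  obtain C where C: "\<And>D. D \<in> packages S \<Longrightarrow> norm (K D) \<le> C * norm_loc S D"
    using assms(2) unfolding bounded_linear_pkg_def by blast
  show ?thesis
  proof (rule bdd_aboveI2)
    fix D assume "D \<in> packages S"
    then have "norm (K D) \<le> C * norm_loc S D" by (rule C)
    \<comment> \<open>The constant \<open>C\<close> may be negative when all packages have norm
      zero. Passing to \<open>max C 0\<close> also covers the quotients with zero denominator, which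
      evaluate to 0.\<close>
    also have "\<dots> \<le> max C 0 * norm_loc S D"
      using norm_loc_nonneg[OF assms(1)] by (intro mult_right_mono) auto
    finally show "norm (K D) / norm_loc S D \<le> max C 0"
      using norm_loc_nonneg[OF assms(1), of D]
      by (cases "norm_loc S D = 0") (simp_all add: divide_le_eq)
  qed
qed

lemma onorm_pkg_nonneg:
  assumes "tail_setting_ok S" "bounded_linear_pkg S K"
  shows "0 \<le> onorm_pkg S K"
proof -
  have "0 \<le> norm (K 0) / norm_loc S 0"
    using norm_loc_nonneg[OF assms(1)] by simp
  also have "\<dots> \<le> onorm_pkg S K"
    unfolding onorm_pkg_def
    by (intro cSUP_upper zero_in_packages bdd_above_onorm_pkg assms)
  finally show ?thesis .
qed

lemma norm_le_onorm_pkg: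
  assumes "tail_setting_ok S" "bounded_linear_pkg S K" "D \<in> packages S"
  shows "norm (K D) \<le> onorm_pkg S K * norm_loc S D"
proof (cases "norm_loc S D = 0")
  \<comment> \<open>Here the quotient says nothing about \<open>K D\<close>; the boundedness
    estimate itself forces \<open>K D = 0\<close>.\<close>
  case True
  then show ?thesis using assms(2,3) by (auto simp: bounded_linear_pkg_def)
next
  case False
  have "norm (K D) / norm_loc S D \<le> onorm_pkg S K"
    unfolding onorm_pkg_def by (intro cSUP_upper bdd_above_onorm_pkg assms)
  then show ?thesis
    using False norm_loc_nonneg[OF assms(1), of D] by (simp add: divide_le_eq)
qed

lemma exact_tail_minimizer_imp_tail_selector:
  assumes "exact_tail_minimizer S sel"
  shows "tail_selector S 0 sel"
  unfolding tail_selector_def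
proof
  fix D assume "D \<in> packages S"
  then have sel: "sel D \<in> Gam S"
    and le: "\<And>\<zeta>. \<zeta> \<in> Gam S \<Longrightarrow> tail_objective S D (sel D) \<le> tail_objective S D \<zeta>"
    using assms by (auto simp: exact_tail_minimizer_def is_arg_min_linorder)
  \<comment> \<open>The value at \<open>sel D\<close> is a lower bound of the objective over
    \<open>Gam S\<close>, which \<open>sel D\<close> shows to be nonempty, so it lies below the
    infimum.\<close>
  have "tail_objective S D (sel D) \<le> dist_tail S D"
    unfolding dist_tail_def using sel le by (intro cINF_greatest) auto
  with sel show "sel D \<in> Gam S \<and> tail_objective S D (sel D) \<le> dist_tail S D + 0"
    by simp
qed

text \<open>Stated for arbitrary \<open>\<delta>\<close>, so that it serves both the given selector
  and, with \<open>\<delta> = 0\<close>, the exact minimizer.\<close>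

lemma gate_residual_le:
  assumes S: "tail_setting_ok S" and sel: "tail_selector S \<delta> sel"
    and K: "bounded_linear_pkg S K_det" "bounded_linear_pkg S K_tax" "bounded_linear_pkg S K_slack"
    and D: "D \<in> packages S"
  shows "gate_residual sel K_det K_tax K_slack D \<le>
    (onorm_pkg S K_det + onorm_pkg S K_tax + onorm_pkg S K_slack) * (dist_tail S D + \<delta>)"
    (is "_ \<le> ?C * _")
proof -
  have "sel D \<in> packages S"
    using S sel D by (auto simp: tail_selector_def tail_setting_ok_def)
  note D' = diff_in_packages[OF S D this]
  have le: "norm_loc S (D - sel D) \<le> dist_tail S D + \<delta>"
    using norm_loc_le_tail_objective[OF S, of D "sel D"] sel D
    by (force simp: tail_selector_def)
  have "gate_residual sel K_det K_tax K_slack D \<le> ?C * norm_loc S (D - sel D)"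
    using K[THEN norm_le_onorm_pkg[OF S _ D']]
    by (simp add: gate_residual_def distrib_right)
  \<comment> \<open>Enlarging the norm to \<open>dist_tail S D + \<delta>\<close> keeps the
    inequality because the sum of operator norms is nonnegative.\<close>
  also have "\<dots> \<le> ?C * (dist_tail S D + \<delta>)"
    using le K[THEN onorm_pkg_nonneg[OF S]] by (intro mult_left_mono) auto
  finally show ?thesis .
qed

theorem proposition9p137:
  fixes S :: "('x::real_normed_vector, 'h::real_normed_vector) tail_setting"
    and sel :: "'x package \<Rightarrow> 'x package" and \<delta>_sel :: real
    and K_det :: "'x package \<Rightarrow> 'g1::real_normed_vector"
    and K_tax :: "'x package \<Rightarrow> 'g2::real_normed_vector"
    and K_slack :: "'x package \<Rightarrow> 'g3::real_normed_vector"
  assumes "tail_setting_ok S"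
    and "\<delta>_sel \<ge> 0" and "tail_selector S \<delta>_sel sel"
    and "finite_dimensional (UNIV :: 'g1 set)"
    and "finite_dimensional (UNIV :: 'g2 set)"
    and "finite_dimensional (UNIV :: 'g3 set)"
    and "bounded_linear_pkg S K_det"
    and "bounded_linear_pkg S K_tax"
    and "bounded_linear_pkg S K_slack"
  shows "let C_gate = onorm_pkg S K_det + onorm_pkg S K_tax + onorm_pkg S K_slack;
             R_gate = gate_residual sel K_det K_tax K_slack
         in (\<forall>D\<in>packages S. R_gate D \<le> C_gate * dist_tail S D + C_gate * \<delta>_sel) \<and>
            (exact_tail_minimizer S sel \<longrightarrow>
               tail_selector S 0 sel \<and>
               (\<forall>D\<in>packages S. R_gate D \<le> C_gate * dist_tail S D + 0))"
  using gate_residual_le[OF assms(1) assms(3) assms(7-9)]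
    gate_residual_le[OF assms(1) exact_tail_minimizer_imp_tail_selector assms(7-9)]
    exact_tail_minimizer_imp_tail_selector[of S sel]
  by (auto simp: Let_def distrib_left)

end
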